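(* Let $G$ be a topological group and let $S$ be a topological inverse semigroup (with identity $1$) such that $E(S)$ has small semilattices. (i) If $\theta:G\to S$ is a continuous unital premorphism, then its associated semigroup homomorphism $\widetilde\theta:\widetilde{G}^R\to S$, defined by $$\widetilde\theta(\{1,g_1,\dots,g_n\},g_n)=\theta(g_1)\theta(g_1)^{-1}\cdots\theta(g_{n-1})\theta(g_{n-1})^{-1}\theta(g_n),$$ is continuous. (ii) If $\rho:\widetilde{G}^R\to S$ is a continuous semigroup homomorphism, then its associated unital premorphism $\widehat\rho:G\to S$, given by $\widehat\rho(g)=\rho(\{1,g\},g)$, is continuous.
   Context: A topological inverse semigroup is an inverse semigroup with a topology making multiplication and inversion continuous. Natural partial order: $s\le t$ iff $s=et$ for some idempotent $e$. $E(S)$ is the set of idempotents of $S$ with the subspace topology; it is a meet semilattice with $e\wedge f=ef$. A topological semilattice is a Hausdorff topological space $E$ with a partial order such that any two elements have a greatest lower bound and $(x,y)\mapsto x\wedge y$ is continuous; it has small semilattices if every point has a basis of neighbourhoods which are subsemilattices of $E$. (So the hypothesis includes that $E(S)$ is a topological semilattice in this sense.) A unital premorphism $\theta:G\to S$ is a map with $\theta(1)=1$, $\theta(g^{-1})=\theta(g)^{-1}$ and $\theta(g)\theta(h)\le\theta(gh)$ for all $g,h\in G$. The Birget–Rhodes expansion is $\widetilde{G}^R=\{(A,g): A\subseteq G\text{ finite},\ \{1,g\}\subseteq A\}$ with product $(A,g)(B,h)=(A\cup gB,gh)$ and inverse $(A,g)^{-1}=(g^{-1}A,g^{-1})$. It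 carries the subspace topology from $K(G)\times G$, where $K(G)$ is the set of compact subsets of $G$ with the Vietoris topology, which has as a basis the sets $N(U_1,\dots,U_n)=\{K\in K(G): K\subseteq U_1\cup\dots\cup U_n,\ K\cap U_i\ne\emptyset\text{ for all }i\le n\}$ with each $U_i$ open in $G$. The names "associated semigroup homomorphism" and "associated unital premorphism" refer to Exel's (algebraic) correspondence, given by the displayed formulas; the map $\widetilde\theta$ is well defined and is a homomorphism. *)

theory Defs
  imports "HOL-Analysis.Analysis" "HOL-Algebra.Lattice" "HOL-Algebra.Group"
begin

section \<open>Topological groups\<close>

text \<open>No separation axiom is imposed on a topological group.\<close>

locale topological_group = group G for G (structure) +
  fixes T :: "'a topology"
  assumes topspace_eq: "topspace T = carrier G"
    and continuous_mult: "continuous_map (prod_topology T T) T (\<lambda>(x, y). x \<otimes> y)"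
    and continuous_inv: "continuous_map T T (\<lambda>x. inv x)"


section \<open>Inverse semigroups with identity\<close>

text \<open>
  The operation \<open>m_inv\<close> of HOL-Algebra denotes the inverse of a unit, so the inverse of an inverse
  semigroup needs an operation of its own.
\<close>

definition is_sinv :: "('a, 'm) monoid_scheme \<Rightarrow> 'a \<Rightarrow> 'a \<Rightarrow> bool" where
  "is_sinv S x y \<longleftrightarrow> y \<in> carrier S \<and> x \<otimes>\<^bsub>S\<^esub> y \<otimes>\<^bsub>S\<^esub> x = x \<and> y \<otimes>\<^bsub>S\<^esub> x \<otimes>\<^bsub>S\<^esub> y = y"

definition sinv :: "('a, 'm) monoid_scheme \<Rightarrow> 'a \<Rightarrow> 'a" where
  "sinv S x = (THE y. is_sinv S x y)"

definition idempotents :: "('a, 'm) monoid_scheme \<Rightarrow> 'a set" where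
  "idempotents S = {e \<in> carrier S. e \<otimes>\<^bsub>S\<^esub> e = e}"

definition natural_le :: "('a, 'm) monoid_scheme \<Rightarrow> 'a \<Rightarrow> 'a \<Rightarrow> bool" where
  "natural_le S s t \<longleftrightarrow> (\<exists>e \<in> idempotents S. s = e \<otimes>\<^bsub>S\<^esub> t)"

locale inverse_monoid = monoid S for S (structure) +
  assumes ex1_sinv: "x \<in> carrier S \<Longrightarrow> \<exists>!y. is_sinv S x y"

locale topological_inverse_monoid = inverse_monoid S for S (structure) +
  fixes T :: "'a topology"
  assumes topspace_eq: "topspace T = carrier S"
    and continuous_mult: "continuous_map (prod_topology T T) T (\<lambda>(x, y). x \<otimes> y)"
    and continuous_sinv: "continuous_map T T (sinv S)"

definition idempotent_order :: "('a, 'm) monoid_scheme \<Rightarrow> 'a gorder" where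
  "idempotent_order S = \<lparr>carrier = idempotents S, eq = (=), le = natural_le S\<rparr>"


section \<open>Topological semilattices\<close>

locale topological_semilattice = lower_semilattice L for L (structure) +
  fixes T :: "'a topology"
  assumes topspace_eq: "topspace T = carrier L"
    and Hausdorff: "Hausdorff_space T"
    and continuous_meet: "continuous_map (prod_topology T T) T (\<lambda>(x, y). x \<sqinter> y)"

definition subsemilattice :: "('a, 'm) gorder_scheme \<Rightarrow> 'a set \<Rightarrow> bool" where
  "subsemilattice L N \<longleftrightarrow> N \<subseteq> carrier L \<and> (\<forall>x \<in> N. \<forall>y \<in> N. x \<sqinter>\<^bsub>L\<^esub> y \<in> N)"

definition has_small_semilattices :: "('a, 'm) gorder_scheme \<Rightarrow> 'a topology \<Rightarrow> bool" where
  "has_small_semilattices L T \<longleftrightarrow>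
     topological_semilattice L T \<and> neighbourhood_base_of (subsemilattice L) T"


section \<open>The Vietoris topology on the compact subsets\<close>

text \<open>
  The empty family is allowed: \<open>vietoris_basic T {}\<close> is \<open>{{}}\<close>, without which the empty compact
  set would lie in no basic set. It is never a member of the Birget-Rhodes expansion.
\<close>

definition vietoris_basic :: "'a topology \<Rightarrow> 'a set set \<Rightarrow> 'a set set" where
  "vietoris_basic T \<U> = {K. compactin T K \<and> K \<subseteq> \<Union>\<U> \<and> (\<forall>U \<in> \<U>. K \<inter> U \<noteq> {})}"

definition vietoris :: "'a topology \<Rightarrow> 'a set topology" where
  "vietoris T = topology_generated_by
     {vietoris_basic T \<U> | \<U>. finite \<U> \<and> (\<forall>U \<in> \<U>. openin T U)}"


section \<open>The Birget-Rhodes expansion\<close>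

definition birget_rhodes :: "('g, 'm) monoid_scheme \<Rightarrow> ('g set \<times> 'g) monoid" where
  "birget_rhodes G =
     \<lparr>carrier = {(A, g). finite A \<and> A \<subseteq> carrier G \<and> {\<one>\<^bsub>G\<^esub>, g} \<subseteq> A},
      mult = (\<lambda>(A, g) (B, h). (A \<union> (\<lambda>b. g \<otimes>\<^bsub>G\<^esub> b) ` B, g \<otimes>\<^bsub>G\<^esub> h)),
      one = ({\<one>\<^bsub>G\<^esub>}, \<one>\<^bsub>G\<^esub>)\<rparr>"

definition birget_rhodes_topology ::
    "('g, 'm) monoid_scheme \<Rightarrow> 'g topology \<Rightarrow> ('g set \<times> 'g) topology" where
  "birget_rhodes_topology G T =
     subtopology (prod_topology (vietoris T) T) (carrier (birget_rhodes G))"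


section \<open>Unital premorphisms and the correspondence\<close>

definition unital_premorphism ::
    "('g, 'm) monoid_scheme \<Rightarrow> ('s, 'n) monoid_scheme \<Rightarrow> ('g \<Rightarrow> 's) \<Rightarrow> bool" where
  "unital_premorphism G S \<theta> \<longleftrightarrow>
     \<theta> \<in> carrier G \<rightarrow> carrier S \<and>
     \<theta> \<one>\<^bsub>G\<^esub> = \<one>\<^bsub>S\<^esub> \<and>
     (\<forall>g \<in> carrier G. \<theta> (inv\<^bsub>G\<^esub> g) = sinv S (\<theta> g)) \<and>
     (\<forall>g \<in> carrier G. \<forall>h \<in> carrier G. natural_le S (\<theta> g \<otimes>\<^bsub>S\<^esub> \<theta> h) (\<theta> (g \<otimes>\<^bsub>G\<^esub> h)))"

text \<open>For \<open>gs = [g\<^sub>1, \<dots>, g\<^sub>k]\<close> this is \<open>\<theta>(g\<^sub>1)\<theta>(g\<^sub>1)\<inverse> \<cdots> \<theta>(g\<^sub>k)\<theta>(g\<^sub>k)\<inverse> \<theta>(g)\<close>.\<close>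

definition premorphism_product ::
    "('s, 'n) monoid_scheme \<Rightarrow> ('g \<Rightarrow> 's) \<Rightarrow> 'g list \<Rightarrow> 'g \<Rightarrow> 's" where
  "premorphism_product S \<theta> gs g =
     foldr (\<lambda>h t. (\<theta> h \<otimes>\<^bsub>S\<^esub> sinv S (\<theta> h)) \<otimes>\<^bsub>S\<^esub> t) gs (\<theta> g)"

text \<open>
  The value at \<open>(A, g)\<close> is the one common to all enumerations \<open>A = {1, g\<^sub>1, \<dots>, g\<^sub>k, g}\<close>;
  see \<open>associated_hom_eq\<close> below.
\<close>

definition associated_hom ::
    "('g, 'm) monoid_scheme \<Rightarrow> ('s, 'n) monoid_scheme \<Rightarrow> ('g \<Rightarrow> 's) \<Rightarrow> 'g set \<times> 'g \<Rightarrow> 's" where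
  "associated_hom G S \<theta> = (\<lambda>(A, g).
     THE s. \<exists>gs. A = {\<one>\<^bsub>G\<^esub>, g} \<union> set gs \<and> s = premorphism_product S \<theta> gs g)"

definition associated_premorphism ::
    "('g, 'm) monoid_scheme \<Rightarrow> ('g set \<times> 'g \<Rightarrow> 's) \<Rightarrow> 'g \<Rightarrow> 's" where
  "associated_premorphism G \<rho> = (\<lambda>g. \<rho> ({\<one>\<^bsub>G\<^esub>, g}, g))"


section \<open>Well-definedness of the associated homomorphism\<close>

context inverse_monoid
begin

lemma is_sinv_sinv: "x \<in> carrier S \<Longrightarrow> is_sinv S x (sinv S x)"
  unfolding sinv_def by (rule theI') (rule ex1_sinv)

lemma sinv_closed: "x \<in> carrier S \<Longrightarrow> sinv S x \<in> carrier S"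
  using is_sinv_sinv by (auto simp: is_sinv_def)

lemma sinv_unique: "\<lbrakk>x \<in> carrier S; is_sinv S x y; is_sinv S x z\<rbrakk> \<Longrightarrow> y = z"
  using ex1_sinv by blast

lemma mult_sinv_cancel: "x \<in> carrier S \<Longrightarrow> (x \<otimes> sinv S x) \<otimes> x = x"
  using is_sinv_sinv by (auto simp: is_sinv_def)

lemma mult_sinv_idempotent: "x \<in> carrier S \<Longrightarrow> x \<otimes> sinv S x \<in> idempotents S"
  using mult_sinv_cancel[of x] sinv_closed[of x]
  by (simp add: idempotents_def) (metis m_assoc m_closed)

lemma idempotents_mult_closed:
  assumes "e \<in> idempotents S" "f \<in> idempotents S"
  shows "e \<otimes> f \<in> idempotents S"
proof -
  have c: "e \<in> carrier S" "f \<in> carrier S" and ee: "e \<otimes> e = e" and ff: "f \<otimes> f = f"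
    using assms by (auto simp: idempotents_def)
  define x where "x = sinv S (e \<otimes> f)"
  have xc: "x \<in> carrier S" using c by (simp add: x_def sinv_closed)
  have x: "is_sinv S (e \<otimes> f) x" using c by (simp add: x_def is_sinv_sinv)
  have ee': "e \<otimes> (e \<otimes> z) = e \<otimes> z" and ff': "f \<otimes> (f \<otimes> z) = f \<otimes> z" if "z \<in> carrier S" for z
    using that c ee ff by (metis m_assoc)+
  have x1: "e \<otimes> (f \<otimes> (x \<otimes> (e \<otimes> f))) = e \<otimes> f" and x2: "x \<otimes> (e \<otimes> (f \<otimes> x)) = x"
    using x c xc by (auto simp: is_sinv_def m_assoc)
  have x2': "x \<otimes> (e \<otimes> (f \<otimes> (x \<otimes> z))) = x \<otimes> z" if "z \<in> carrier S" for z
  proof -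
    have "(x \<otimes> (e \<otimes> (f \<otimes> x))) \<otimes> z = x \<otimes> z" by (simp add: x2)
    then show ?thesis using that c xc by (simp add: m_assoc)
  qed
  have "is_sinv S (e \<otimes> f) (f \<otimes> (x \<otimes> e))"
    using c xc by (simp add: is_sinv_def m_assoc ee' ff' x1 x2')
  then have fxe: "f \<otimes> (x \<otimes> e) = x"
    using sinv_unique x c by blast
  have "(f \<otimes> (x \<otimes> e)) \<otimes> (f \<otimes> (x \<otimes> e)) = f \<otimes> (x \<otimes> e)"
    using c xc by (simp add: m_assoc x2')
  then have xx: "x \<otimes> x = x" by (simp only: fxe)
  have "is_sinv S x x" using xc xx by (simp add: is_sinv_def)
  moreover have "is_sinv S x (e \<otimes> f)" using x c by (simp add: is_sinv_def)
  ultimately have "e \<otimes> f = x" using sinv_unique xc by blast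
  then show ?thesis using xc xx by (simp add: idempotents_def)
qed

lemma idempotents_commute:
  assumes "e \<in> idempotents S" "f \<in> idempotents S"
  shows "e \<otimes> f = f \<otimes> e"
proof -
  have c: "e \<in> carrier S" "f \<in> carrier S" and ee: "e \<otimes> e = e" and ff: "f \<otimes> f = f"
    using assms by (auto simp: idempotents_def)
  have ef: "e \<otimes> (f \<otimes> (e \<otimes> f)) = e \<otimes> f" and fe: "f \<otimes> (e \<otimes> (f \<otimes> e)) = f \<otimes> e"
    using idempotents_mult_closed[OF assms] idempotents_mult_closed[OF assms(2,1)] c
    by (auto simp: idempotents_def m_assoc)
  have ee': "e \<otimes> (e \<otimes> z) = e \<otimes> z" and ff': "f \<otimes> (f \<otimes> z) = f \<otimes> z" if "z \<in> carrier S" for z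
    using that c ee ff by (metis m_assoc)+
  have "is_sinv S (e \<otimes> f) (e \<otimes> f)" "is_sinv S (e \<otimes> f) (f \<otimes> e)"
    using c by (simp_all add: is_sinv_def m_assoc ee' ff' ef fe)
  then show ?thesis using sinv_unique c by blast
qed

lemma premorphism_product_eqI:
  assumes \<theta>: "\<And>h. h \<in> insert u (insert g (set gs \<union> set hs)) \<Longrightarrow> \<theta> h \<in> carrier S"
    and u: "\<theta> u = \<one>"
    and eq: "{u, g} \<union> set gs = {u, g} \<union> set hs"
  shows "premorphism_product S \<theta> gs g = premorphism_product S \<theta> hs g"
proof -
  define C where "C = {h. \<theta> h \<in> carrier S}"
  define e where "e h = \<theta> h \<otimes> sinv S (\<theta> h)" for h
  define P where "P xs t = foldr (\<lambda>h t. e h \<otimes> t) xs t" for xs t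
  have PC [simp]: "P (h # xs) t = e h \<otimes> P xs t" "P [] t = t" for h xs t
    by (simp_all add: P_def)
  have ec: "e h \<in> carrier S" and eI: "e h \<in> idempotents S" if "h \<in> C" for h
    using that mult_sinv_idempotent by (auto simp: C_def e_def idempotents_def)
  have Pc: "P xs t \<in> carrier S" if "set xs \<subseteq> C" "t \<in> carrier S" for xs t
    using that by (induction xs) (auto simp: ec)
  have left_comm: "e h \<otimes> (e k \<otimes> t) = e k \<otimes> (e h \<otimes> t)"
    if "h \<in> C" "k \<in> C" "t \<in> carrier S" for h k t
    using idempotents_commute[of "e h" "e k"] that by (simp add: eI ec flip: m_assoc)
  have idem: "e h \<otimes> (e h \<otimes> t) = e h \<otimes> t" if "h \<in> C" "t \<in> carrier S" for h t
    using eI[of h] that by (simp add: idempotents_def flip: m_assoc)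
  have eP: "e h \<otimes> P xs t = P xs (e h \<otimes> t)" if "h \<in> C" "set xs \<subseteq> C" "t \<in> carrier S" for h xs t
    using that by (induction xs) (auto simp: left_comm Pc)
  have absorb: "e h \<otimes> P xs t = P xs t"
    if "h \<in> set xs" "set xs \<subseteq> C" "t \<in> carrier S" for h xs t
    using that
  proof (induction xs)
    case (Cons a xs)
    then have "h \<in> C" by auto
    with Cons show ?case by (cases "h = a") (auto simp: idem Pc left_comm[of h a])
  qed simp
  have absorb_all: "P xs t = t"
    if "\<And>h. h \<in> set xs \<Longrightarrow> e h \<otimes> t = t" for xs t
    using that by (induction xs) auto
  have PP: "P xs (P ys t) = P ys (P xs t)"
    if "set xs \<subseteq> C" "set ys \<subseteq> C" "t \<in> carrier S" for xs ys t
    using that by (induction xs) (auto simp: eP Pc)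
  have sub: "insert u (insert g (set gs \<union> set hs)) \<subseteq> C" using \<theta> by (auto simp: C_def)
  have gc: "\<theta> g \<in> carrier S" using \<theta> by simp
  have eu: "e u \<otimes> t = t" if "t \<in> carrier S" for t
    using that mult_sinv_cancel[of \<one>] sinv_closed[of \<one>] by (simp add: e_def u)
  have eg: "e g \<otimes> \<theta> g = \<theta> g" using gc by (simp add: e_def mult_sinv_cancel)
  have fix_all: "P xs (P ys (\<theta> g)) = P ys (\<theta> g)"
    if xs: "set xs \<subseteq> {u, g} \<union> set ys" and ys: "set ys \<subseteq> C" for xs ys
  proof (rule absorb_all)
    fix h assume "h \<in> set xs"
    then consider "h = u" | "h = g" | "h \<in> set ys" using xs by auto
    then show "e h \<otimes> P ys (\<theta> g) = P ys (\<theta> g)"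
    proof cases
      case 1 then show ?thesis using eu Pc ys gc by auto
    next
      case 2 then show ?thesis using eP[of g ys "\<theta> g"] eg ys gc sub by auto
    next
      case 3 then show ?thesis using absorb ys gc by auto
    qed
  qed
  have s1: "set gs \<subseteq> {u, g} \<union> set hs" and s2: "set hs \<subseteq> {u, g} \<union> set gs"
    using eq by blast+
  have "P gs (\<theta> g) = P hs (P gs (\<theta> g))"
    using fix_all[OF s2] sub by auto
  also have "\<dots> = P gs (P hs (\<theta> g))" using PP[of hs gs "\<theta> g"] sub gc by auto
  also have "\<dots> = P hs (\<theta> g)" using fix_all[OF s1] sub by auto
  finally show ?thesis by (simp add: premorphism_product_def P_def e_def)
qed

end

lemma associated_hom_eq:
  assumes "group G" "inverse_monoid S" "unital_premorphism G S \<theta>"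
    and "set gs \<subseteq> carrier G" "g \<in> carrier G"
  shows "associated_hom G S \<theta> ({\<one>\<^bsub>G\<^esub>, g} \<union> set gs, g) = premorphism_product S \<theta> gs g"
proof -
  interpret G: group G by fact
  interpret S: inverse_monoid S by fact
  have \<theta>: "\<theta> h \<in> carrier S" if "h \<in> carrier G" for h
    using that assms(3) by (auto simp: unital_premorphism_def)
  have one: "\<theta> \<one>\<^bsub>G\<^esub> = \<one>\<^bsub>S\<^esub>" using assms(3) by (simp add: unital_premorphism_def)
  have "premorphism_product S \<theta> hs g = premorphism_product S \<theta> gs g"
    if eq: "{\<one>\<^bsub>G\<^esub>, g} \<union> set gs = {\<one>\<^bsub>G\<^esub>, g} \<union> set hs" for hs
  proof (rule S.premorphism_product_eqI[where u = "\<one>\<^bsub>G\<^esub>"])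
    have "set hs \<subseteq> carrier G" using eq assms(4,5)
      by (metis G.one_closed Un_subset_iff empty_subsetI insert_subset)
    then show "\<theta> h \<in> carrier S" if "h \<in> insert \<one>\<^bsub>G\<^esub> (insert g (set hs \<union> set gs))" for h
      using that assms(4,5) \<theta> by auto
  qed (use one eq in auto)
  then show ?thesis
    unfolding associated_hom_def prod.case by (intro the_equality) blast+
qed

end

theory Submission
  imports Defs
begin

text \<open>
  For a unital premorphism \<open>\<theta>\<close> write \<open>e(a) = \<theta>(a)\<theta>(a)\<inverse>\<close>. Since \<open>e(1) = 1\<close> and
  \<open>e(g)\<theta>(g) = \<theta>(g)\<close>, the associated homomorphism factors as \<open>(A, g) \<mapsto> F(A) \<theta>(g)\<close>, where
  \<open>F(A)\<close> is the product of the commuting idempotents \<open>e(a)\<close> over \<open>a \<in> A\<close>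
  (\<open>associated_hom_factorisation\<close>). So its continuity reduces to that of \<open>F\<close> on finite sets for
  the Vietoris topology.

  Let \<open>A = {a\<^sub>1, \<dots>, a\<^sub>n}\<close> and \<open>F(A) \<in> W\<close> with \<open>W\<close> open. By continuity of multiplication there are
  neighbourhoods \<open>V\<^sub>i\<close> of \<open>e(a\<^sub>i)\<close> with \<open>V\<^sub>1 \<cdots> V\<^sub>n \<subseteq> W\<close>, and they may be taken to be
  subsemilattices of the idempotents. Choose an open \<open>U\<^sub>i\<close> around \<open>a\<^sub>i\<close> with \<open>e(U\<^sub>i) \<subseteq> V\<^sub>i\<close>. A finite
  \<open>B \<in> N(U\<^sub>1, \<dots>, U\<^sub>n)\<close> is the union of its nonempty parts \<open>B \<inter> U\<^sub>i\<close>. The product over each part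
  stays in \<open>V\<^sub>i\<close>, however large the part is, and overlaps do not matter because the factors are
  commuting idempotents. Hence \<open>F(B) \<in> V\<^sub>1 \<cdots> V\<^sub>n \<subseteq> W\<close>; this is
  \<open>idempotent_product_vietoris_neighbourhood\<close>, where it is arranged as an induction on \<open>A\<close>.

  Conversely, the premorphism associated with \<open>\<rho>\<close> is \<open>\<rho>\<close> composed with \<open>g \<mapsto> ({1, g}, g)\<close>, and the
  latter is continuous (\<open>continuous_birget_rhodes_section\<close>) because \<open>x \<mapsto> {c, x}\<close> is continuous into
  the Vietoris topology.
\<close>

section \<open>Meets of idempotents\<close>

context inverse_monoid
begin

lemma natural_le_idempotents_iff:
  assumes "e \<in> idempotents S" "f \<in> idempotents S"
  shows "natural_le S e f \<longleftrightarrow> e \<otimes> f = e"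
proof
  assume "natural_le S e f"
  then obtain d where "d \<in> idempotents S" "e = d \<otimes> f"
    by (auto simp: natural_le_def)
  with assms show "e \<otimes> f = e"
    by (simp add: idempotents_def m_assoc)
next
  assume "e \<otimes> f = e"
  with assms show "natural_le S e f"
    by (auto simp: natural_le_def intro!: bexI[of _ e])
qed

text \<open>
  This turns the subsemilattices of the idempotents, which are defined through the order, into
  sets closed under multiplication.
\<close>

lemma meet_idempotents:
  assumes e: "e \<in> idempotents S" and f: "f \<in> idempotents S"
  shows "e \<sqinter>\<^bsub>idempotent_order S\<^esub> f = e \<otimes> f"
proof -
  have ef: "e \<otimes> f \<in> idempotents S"
    using e f by (rule idempotents_mult_closed)
  have c: "x \<in> carrier S" "x \<otimes> x = x" if "x \<in> idempotents S" for x
    using that by (auto simp: idempotents_def)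
  have greatest_iff: "greatest (idempotent_order S) z (Lower (idempotent_order S) {e, f}) \<longleftrightarrow>
      z \<in> idempotents S \<and> z \<otimes> e = z \<and> z \<otimes> f = z \<and>
      (\<forall>d \<in> idempotents S. d \<otimes> e = d \<and> d \<otimes> f = d \<longrightarrow> d \<otimes> z = d)" for z
    using e f unfolding greatest_def Lower_def idempotent_order_def
    by (auto simp: natural_le_idempotents_iff)
  have "greatest (idempotent_order S) (e \<otimes> f) (Lower (idempotent_order S) {e, f})"
    unfolding greatest_iff
  proof (intro conjI ballI impI ef)
    show "(e \<otimes> f) \<otimes> f = e \<otimes> f"
      using c[OF e] c[OF f] by (simp add: m_assoc)
    show "(e \<otimes> f) \<otimes> e = e \<otimes> f"
      using c[OF e] c[OF f] by (metis idempotents_commute[OF e f] m_assoc)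
    show "d \<otimes> (e \<otimes> f) = d" if "d \<in> idempotents S" "d \<otimes> e = d \<and> d \<otimes> f = d" for d
      using that c[OF e] c[OF f] c[OF that(1)] by (metis m_assoc)
  qed
  moreover have "z = e \<otimes> f"
    if "greatest (idempotent_order S) z (Lower (idempotent_order S) {e, f})" for z
    using that calculation idempotents_commute unfolding greatest_iff by metis
  ultimately show ?thesis
    unfolding meet_def inf_def by (rule some_equality)
qed

end


section \<open>Products of the idempotents of a unital premorphism\<close>

locale premorphism_of_group = G: group G + S: inverse_monoid S
  for G :: "('g, 'm) monoid_scheme" and S :: "('s, 'n) monoid_scheme" +
  fixes \<theta> :: "'g \<Rightarrow> 's"
  assumes unital_premorphism: "unital_premorphism G S \<theta>"
begin

lemma map_closed: "g \<in> carrier G \<Longrightarrow> \<theta> g \<in> carrier S"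
  and map_one: "\<theta> \<one>\<^bsub>G\<^esub> = \<one>\<^bsub>S\<^esub>"
  using unital_premorphism by (auto simp: unital_premorphism_def)

abbreviation range_idempotent :: "'g \<Rightarrow> 's" where
  "range_idempotent g \<equiv> \<theta> g \<otimes>\<^bsub>S\<^esub> sinv S (\<theta> g)"

lemma range_idempotent: "g \<in> carrier G \<Longrightarrow> range_idempotent g \<in> idempotents S"
  by (simp add: map_closed S.mult_sinv_idempotent)

lemma range_idempotent_closed: "g \<in> carrier G \<Longrightarrow> range_idempotent g \<in> carrier S"
  by (simp add: map_closed S.sinv_closed)

text \<open>
  For finite \<open>A\<close> this is the product of the idempotents \<open>\<theta>(a)\<theta>(a)\<inverse>\<close> over \<open>a \<in> A\<close>. Reading it off the
  associated homomorphism makes its independence of the enumeration of \<open>A\<close>, repetitions included,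
  available at once.
\<close>

definition idempotent_product :: "'g set \<Rightarrow> 's" where
  "idempotent_product A = associated_hom G S \<theta> (insert \<one>\<^bsub>G\<^esub> A, \<one>\<^bsub>G\<^esub>)"

lemma idempotent_product_set:
  assumes "set gs \<subseteq> carrier G"
  shows "idempotent_product (set gs) = premorphism_product S \<theta> gs \<one>\<^bsub>G\<^esub>"
  using associated_hom_eq[OF G.group_axioms S.inverse_monoid_axioms unital_premorphism assms G.one_closed]
  by (simp add: idempotent_product_def)

lemma premorphism_product_closed:
  "\<lbrakk>set gs \<subseteq> carrier G; g \<in> carrier G\<rbrakk> \<Longrightarrow> premorphism_product S \<theta> gs g \<in> carrier S"
  by (induction gs) (auto simp: premorphism_product_def map_closed range_idempotent_closed)

lemma premorphism_product_append:
  assumes "set gs \<subseteq> carrier G" "set hs \<subseteq> carrier G" "g \<in> carrier G"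
  shows "premorphism_product S \<theta> (gs @ hs) g =
    premorphism_product S \<theta> gs \<one>\<^bsub>G\<^esub> \<otimes>\<^bsub>S\<^esub> premorphism_product S \<theta> hs g"
  using assms(1)
proof (induction gs)
  case Nil
  then show ?case
    using premorphism_product_closed[OF assms(2,3)] by (simp add: premorphism_product_def map_one)
next
  case (Cons a gs)
  then show ?case
    using premorphism_product_closed[OF assms(2,3)] premorphism_product_closed[of gs "\<one>\<^bsub>G\<^esub>"]
      range_idempotent_closed[of a]
    by (simp add: premorphism_product_def S.m_assoc)
qed

lemma idempotent_product_closed:
  assumes "finite A" "A \<subseteq> carrier G"
  shows "idempotent_product A \<in> carrier S"
  using assms finite_list[OF assms(1)] by (auto simp: idempotent_product_set premorphism_product_closed)

lemma idempotent_product_empty: "idempotent_product {} = \<one>\<^bsub>S\<^esub>"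
  using idempotent_product_set[of "[]"] by (simp add: premorphism_product_def map_one)

lemma idempotent_product_singleton:
  assumes "a \<in> carrier G"
  shows "idempotent_product {a} = range_idempotent a"
  using idempotent_product_set[of "[a]"] assms range_idempotent_closed[OF assms]
  by (simp add: premorphism_product_def map_one)

lemma idempotent_product_Un:
  assumes "finite A" "A \<subseteq> carrier G" "finite B" "B \<subseteq> carrier G"
  shows "idempotent_product (A \<union> B) = idempotent_product A \<otimes>\<^bsub>S\<^esub> idempotent_product B"
proof -
  obtain gs hs where "A = set gs" "B = set hs"
    using assms finite_list by metis
  with assms show ?thesis
    using idempotent_product_set[of "gs @ hs"] premorphism_product_append[of gs hs "\<one>\<^bsub>G\<^esub>"]
    by (simp add: idempotent_product_set)
qed

lemma idempotent_product_in_subsemigroup: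
  assumes closed: "\<And>x y. \<lbrakk>x \<in> V; y \<in> V\<rbrakk> \<Longrightarrow> x \<otimes>\<^bsub>S\<^esub> y \<in> V"
    and "finite B" "B \<noteq> {}" "B \<subseteq> carrier G" "range_idempotent ` B \<subseteq> V"
  shows "idempotent_product B \<in> V"
  using assms(2-)
proof (induction rule: finite_ne_induct)
  case (singleton b)
  then show ?case by (simp add: idempotent_product_singleton)
next
  case (insert b B)
  then show ?case
    using idempotent_product_Un[of "{b}" B] closed by (simp add: idempotent_product_singleton)
qed

text \<open>
  The points \<open>1\<close> and \<open>g\<close> of \<open>A\<close> may take part in the product, because \<open>\<theta>(1)\<theta>(1)\<inverse> = 1\<close> and
  \<open>\<theta>(g)\<theta>(g)\<inverse>\<theta>(g) = \<theta>(g)\<close>. The first factor then depends on \<open>A\<close> alone and the second on \<open>g\<close> alone.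
\<close>

lemma associated_hom_factorisation:
  assumes "(A, g) \<in> carrier (birget_rhodes G)"
  shows "associated_hom G S \<theta> (A, g) = idempotent_product A \<otimes>\<^bsub>S\<^esub> \<theta> g"
proof -
  have A: "finite A" "A \<subseteq> carrier G" "{\<one>\<^bsub>G\<^esub>, g} \<union> A = A" and g: "g \<in> carrier G"
    using assms by (auto simp: birget_rhodes_def)
  obtain gs where gs: "A = set gs"
    using finite_list[OF A(1)] by blast
  have "associated_hom G S \<theta> (A, g) = premorphism_product S \<theta> gs g"
    using associated_hom_eq[OF G.group_axioms S.inverse_monoid_axioms unital_premorphism, of gs g]
      A g gs by simp
  also have "\<dots> = premorphism_product S \<theta> (gs @ []) g" by simp
  also have "\<dots> = idempotent_product A \<otimes>\<^bsub>S\<^esub> \<theta> g"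
    using premorphism_product_append[of gs "[]" g] A g gs
    by (simp add: idempotent_product_set) (simp add: premorphism_product_def)
  finally show ?thesis .
qed

end


section \<open>Continuity in the Vietoris topology\<close>

lemma openin_vietoris_basic:
  "\<lbrakk>finite \<U>; \<And>U. U \<in> \<U> \<Longrightarrow> openin T U\<rbrakk> \<Longrightarrow> openin (vietoris T) (vietoris_basic T \<U>)"
  unfolding vietoris_def openin_topology_generated_by_iff by (intro generate_topology_on.Basis) auto

lemma topological_inverse_monoid_product_neighbourhoods:
  assumes "topological_inverse_monoid S TS" "x \<in> carrier S" "y \<in> carrier S"
    and "openin TS W" "x \<otimes>\<^bsub>S\<^esub> y \<in> W"
  obtains U V where "openin TS U" "x \<in> U" "openin TS V" "y \<in> V"
    "\<And>u v. \<lbrakk>u \<in> U; v \<in> V\<rbrakk> \<Longrightarrow> u \<otimes>\<^bsub>S\<^esub> v \<in> W"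
proof -
  interpret topological_inverse_monoid S TS by fact
  let ?W = "{p \<in> topspace (prod_topology TS TS). (\<lambda>(x, y). x \<otimes>\<^bsub>S\<^esub> y) p \<in> W}"
  have "openin (prod_topology TS TS) ?W"
    using continuous_mult assms(4) by (rule openin_continuous_map_preimage)
  moreover have "(x, y) \<in> ?W"
    using assms by (simp add: topspace_eq)
  ultimately have "\<exists>U V. openin TS U \<and> openin TS V \<and> x \<in> U \<and> y \<in> V \<and> U \<times> V \<subseteq> ?W"
    unfolding openin_prod_topology_alt by (elim allE[of _ x] allE[of _ y] impE)
  then obtain U V where "openin TS U" "openin TS V" "x \<in> U" "y \<in> V" "U \<times> V \<subseteq> ?W"
    by (elim exE conjE)
  then show thesis by (intro that[of U V]) auto
qed

text \<open>
  The induction adds one point \<open>a\<close> at a time. All the idempotents of points near \<open>a\<close> lie in one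
  small semilattice, so their product stays close to the idempotent of \<open>a\<close> however many points
  there are; without small semilattices it could drift away as their number grows. A set \<open>B\<close> near
  \<open>insert a A\<close> is the union of the part in the neighbourhood of \<open>a\<close>, which is nonempty, and the part
  near \<open>A\<close>; these may overlap, which is harmless for a product of commuting idempotents.
\<close>

lemma (in premorphism_of_group) idempotent_product_vietoris_neighbourhood:
  assumes G: "topological_group G TG" and S: "topological_inverse_monoid S TS"
    and E: "has_small_semilattices (idempotent_order S) (subtopology TS (idempotents S))"
    and \<theta>: "continuous_map TG TS \<theta>"
    and "finite A" "A \<subseteq> carrier G" "openin TS W" "idempotent_product A \<in> W"
  obtains \<U> where "finite \<U>" "\<And>U. U \<in> \<U> \<Longrightarrow> openin TG U" "A \<in> vietoris_basic TG \<U>"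
    "\<And>B. \<lbrakk>finite B; B \<in> vietoris_basic TG \<U>\<rbrakk> \<Longrightarrow> idempotent_product B \<in> W"
proof -
  interpret TG: topological_group G TG by fact
  interpret TS: topological_inverse_monoid S TS by fact
  have e: "continuous_map TG (subtopology TS (idempotents S)) range_idempotent"
  proof -
    have "continuous_map TG (prod_topology TS TS) (\<lambda>g. (\<theta> g, sinv S (\<theta> g)))"
      using \<theta> continuous_map_compose[OF \<theta> TS.continuous_sinv]
      by (simp add: continuous_map_pairedI o_def)
    from continuous_map_compose[OF this TS.continuous_mult]
    have "continuous_map TG TS range_idempotent" by (simp add: o_def)
    then show ?thesis
      using range_idempotent by (auto simp: continuous_map_in_subtopology TG.topspace_eq)
  qed
  have "\<exists>\<U>. finite \<U> \<and> (\<forall>U \<in> \<U>. openin TG U) \<and> A \<in> vietoris_basic TG \<U> \<and>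
      (\<forall>B. finite B \<and> B \<in> vietoris_basic TG \<U> \<longrightarrow> idempotent_product B \<in> W)"
    using assms(5-)
  proof (induction arbitrary: W rule: finite_induct)
    case empty
    then show ?case by (intro exI[of _ "{}"]) (simp add: vietoris_basic_def)
  next
    case (insert a A)
    have a: "a \<in> carrier G" and A: "A \<subseteq> carrier G" using insert.prems by auto
    have "range_idempotent a \<otimes>\<^bsub>S\<^esub> idempotent_product A \<in> W"
      using idempotent_product_Un[of "{a}" A] insert a A by (simp add: idempotent_product_singleton)
    from topological_inverse_monoid_product_neighbourhoods
        [OF S range_idempotent_closed[OF a] idempotent_product_closed[OF insert.hyps(1) A]
          insert.prems(2) this]
    obtain O1 O2 where O1: "openin TS O1" "range_idempotent a \<in> O1"
      and O2: "openin TS O2" "idempotent_product A \<in> O2"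
      and O12: "\<And>u v. \<lbrakk>u \<in> O1; v \<in> O2\<rbrakk> \<Longrightarrow> u \<otimes>\<^bsub>S\<^esub> v \<in> W"
      by metis
    from insert.IH[OF A O2] obtain \<U> where \<U>: "finite \<U>" "\<forall>U \<in> \<U>. openin TG U"
      "A \<in> vietoris_basic TG \<U>"
      and \<U>_prod: "\<And>B. \<lbrakk>finite B; B \<in> vietoris_basic TG \<U>\<rbrakk> \<Longrightarrow> idempotent_product B \<in> O2"
      by blast
    have "openin (subtopology TS (idempotents S)) (O1 \<inter> idempotents S)"
      using O1(1) by (auto simp: openin_subtopology)
    moreover have "range_idempotent a \<in> O1 \<inter> idempotents S"
      using O1(2) range_idempotent[OF a] by simp
    ultimately obtain U0 V where U0: "openin (subtopology TS (idempotents S)) U0"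
      "range_idempotent a \<in> U0" "U0 \<subseteq> V" "V \<subseteq> O1 \<inter> idempotents S"
      and V: "subsemilattice (idempotent_order S) V"
      using E unfolding has_small_semilattices_def neighbourhood_base_of by metis
    have V_closed: "x \<otimes>\<^bsub>S\<^esub> y \<in> V" if "x \<in> V" "y \<in> V" for x y
    proof -
      have "x \<sqinter>\<^bsub>idempotent_order S\<^esub> y \<in> V"
        using V that by (auto simp: subsemilattice_def)
      moreover have "x \<in> idempotents S" "y \<in> idempotents S"
        using U0(4) that by auto
      ultimately show ?thesis
        by (simp add: S.meet_idempotents)
    qed
    define U where "U = {g \<in> topspace TG. range_idempotent g \<in> U0}"
    have U: "openin TG U"
      unfolding U_def using e U0(1) by (rule openin_continuous_map_preimage)
    have aU: "a \<in> U" using a U0(2) by (simp add: U_def TG.topspace_eq)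
    show ?case
    proof (intro exI[of _ "insert U \<U>"] conjI allI impI)
      show "insert a A \<in> vietoris_basic TG (insert U \<U>)"
        using \<U>(3) aU insert.hyps(1) insert.prems(1)
        by (auto simp: vietoris_basic_def TG.topspace_eq intro!: finite_imp_compactin)
      fix B assume B: "finite B \<and> B \<in> vietoris_basic TG (insert U \<U>)"
      then have "compactin TG B" by (simp add: vietoris_basic_def)
      then have B_carrier: "B \<subseteq> carrier G"
        using compactin_subset_topspace TG.topspace_eq by metis
      have "idempotent_product (B \<inter> U) \<in> V"
        using B B_carrier U0(3)
        by (intro idempotent_product_in_subsemigroup V_closed) (auto simp: vietoris_basic_def U_def)
      moreover have "B \<inter> \<Union>\<U> \<inter> U' = B \<inter> U'" if "U' \<in> \<U>" for U'
        using that by blast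
      then have "B \<inter> \<Union>\<U> \<in> vietoris_basic TG \<U>"
        using B B_carrier unfolding vietoris_basic_def mem_Collect_eq
        by (intro conjI ballI finite_imp_compactin) (auto simp: TG.topspace_eq)
      then have "idempotent_product (B \<inter> \<Union>\<U>) \<in> O2"
        using \<U>_prod B by blast
      ultimately have "idempotent_product (B \<inter> U) \<otimes>\<^bsub>S\<^esub> idempotent_product (B \<inter> \<Union>\<U>) \<in> W"
        using O12 U0(4) by blast
      moreover have "B = (B \<inter> U) \<union> (B \<inter> \<Union>\<U>)"
        using B by (auto simp: vietoris_basic_def)
      ultimately show "idempotent_product B \<in> W"
        using idempotent_product_Un[of "B \<inter> U" "B \<inter> \<Union>\<U>"] B B_carrier by (metis finite_Int inf.coboundedI1)
    qed (use \<U> U in auto)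
  qed
  then show thesis using that by blast
qed

lemma (in premorphism_of_group) continuous_idempotent_product:
  assumes G: "topological_group G TG" and S: "topological_inverse_monoid S TS"
    and E: "has_small_semilattices (idempotent_order S) (subtopology TS (idempotents S))"
    and \<theta>: "continuous_map TG TS \<theta>"
  shows "continuous_map (subtopology (vietoris TG) {A. finite A \<and> A \<subseteq> carrier G}) TS idempotent_product"
    (is "continuous_map ?X _ _")
proof -
  interpret TG: topological_group G TG by fact
  interpret TS: topological_inverse_monoid S TS by fact
  show ?thesis
    unfolding continuous_map_def
  proof (intro conjI allI impI)
    show "idempotent_product \<in> topspace ?X \<rightarrow> topspace TS"
      by (auto simp: TS.topspace_eq idempotent_product_closed)
    fix W assume W: "openin TS W"
    show "openin ?X {A \<in> topspace ?X. idempotent_product A \<in> W}"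
    proof (subst openin_subopen, intro ballI)
      fix A assume A: "A \<in> {A \<in> topspace ?X. idempotent_product A \<in> W}"
      then have "finite A" "A \<subseteq> carrier G" "idempotent_product A \<in> W" by auto
      from idempotent_product_vietoris_neighbourhood[OF assms this(1,2) W this(3)]
      obtain \<U> where \<U>: "finite \<U>" "\<And>U. U \<in> \<U> \<Longrightarrow> openin TG U" "A \<in> vietoris_basic TG \<U>"
        and prod: "\<And>B. \<lbrakk>finite B; B \<in> vietoris_basic TG \<U>\<rbrakk> \<Longrightarrow> idempotent_product B \<in> W"
        by blast
      let ?N = "vietoris_basic TG \<U> \<inter> {A. finite A \<and> A \<subseteq> carrier G}"
      have N: "openin ?X ?N"
        using openin_vietoris_basic[OF \<U>(1,2)] by (auto simp: openin_subtopology)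
      show "\<exists>N. openin ?X N \<and> A \<in> N \<and> N \<subseteq> {A \<in> topspace ?X. idempotent_product A \<in> W}"
        using N A \<U>(3) prod openin_subset[OF N] by (intro exI[of _ ?N]) auto
    qed
  qed
qed

lemma (in premorphism_of_group) continuous_associated_hom:
  assumes G: "topological_group G TG" and S: "topological_inverse_monoid S TS"
    and E: "has_small_semilattices (idempotent_order S) (subtopology TS (idempotents S))"
    and \<theta>: "continuous_map TG TS \<theta>"
  shows "continuous_map (birget_rhodes_topology G TG) TS (associated_hom G S \<theta>)"
proof -
  interpret TS: topological_inverse_monoid S TS by fact
  let ?Y = "birget_rhodes_topology G TG"
  have "continuous_map ?Y (subtopology (vietoris TG) {A. finite A \<and> A \<subseteq> carrier G}) fst"
    unfolding birget_rhodes_topology_def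
    by (auto simp: continuous_map_in_subtopology birget_rhodes_def
        intro!: continuous_map_from_subtopology continuous_map_fst)
  from continuous_map_compose[OF this continuous_idempotent_product[OF assms]]
  have F: "continuous_map ?Y TS (\<lambda>p. idempotent_product (fst p))" by (simp add: o_def)
  have "continuous_map ?Y TG snd"
    unfolding birget_rhodes_topology_def
    by (intro continuous_map_from_subtopology continuous_map_snd)
  from continuous_map_compose[OF this \<theta>]
  have "continuous_map ?Y TS (\<lambda>p. \<theta> (snd p))" by (simp add: o_def)
  with F have "continuous_map ?Y (prod_topology TS TS) (\<lambda>p. (idempotent_product (fst p), \<theta> (snd p)))"
    by (simp add: continuous_map_pairedI)
  from continuous_map_compose[OF this TS.continuous_mult]
  have "continuous_map ?Y TS (\<lambda>p. idempotent_product (fst p) \<otimes>\<^bsub>S\<^esub> \<theta> (snd p))" by (simp add: o_def)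
  then show ?thesis
    by (rule continuous_map_eq)
      (auto simp: birget_rhodes_topology_def associated_hom_factorisation)
qed


section \<open>The canonical section of the expansion\<close>

lemma continuous_map_vietoris_pair:
  assumes c: "c \<in> topspace T"
  shows "continuous_map T (vietoris T) (\<lambda>x. {c, x})"
  unfolding vietoris_def
proof (rule continuous_on_generated_topo)
  fix N assume "N \<in> {vietoris_basic T \<U> |\<U>. finite \<U> \<and> (\<forall>U \<in> \<U>. openin T U)}"
  then obtain \<U> where N: "N = vietoris_basic T \<U>" and \<U>: "finite \<U>" "\<forall>U \<in> \<U>. openin T U"
    by blast
  show "openin T ((\<lambda>x. {c, x}) -` N \<inter> topspace T)"
  proof (cases "c \<in> \<Union>\<U>")
    case True
    \<comment> \<open>The point \<open>c\<close> already meets some members of \<open>\<U>\<close>; only the others must be met by \<open>x\<close>.\<close>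
    have "(\<lambda>x. {c, x}) -` N \<inter> topspace T = \<Union>\<U> \<inter> (topspace T \<inter> \<Inter>{U \<in> \<U>. c \<notin> U})"
      using True c by (auto simp: N vietoris_basic_def intro!: finite_imp_compactin)
    moreover have "openin T (topspace T \<inter> \<Inter>{U \<in> \<U>. c \<notin> U})"
      using \<U> by (intro openin_Int_Inter) auto
    ultimately show ?thesis
      using \<U> by (simp add: openin_Int openin_Union)
  next
    case False
    then have "(\<lambda>x. {c, x}) -` N \<inter> topspace T = {}"
      by (auto simp: N vietoris_basic_def)
    then show ?thesis by simp
  qed
next
  have "{c, x} \<in> vietoris_basic T {topspace T}" if "x \<in> topspace T" for x
    using c that by (auto simp: vietoris_basic_def intro!: finite_imp_compactin)
  moreover have "vietoris_basic T {topspace T} \<in>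
      {vietoris_basic T \<U> |\<U>. finite \<U> \<and> (\<forall>U \<in> \<U>. openin T U)}"
    by blast
  ultimately show "(\<lambda>x. {c, x}) ` topspace T
      \<subseteq> \<Union>{vietoris_basic T \<U> |\<U>. finite \<U> \<and> (\<forall>U \<in> \<U>. openin T U)}"
    by blast
qed

lemma continuous_birget_rhodes_section:
  assumes "topological_group G TG"
  shows "continuous_map TG (birget_rhodes_topology G TG) (\<lambda>g. ({\<one>\<^bsub>G\<^esub>, g}, g))"
proof -
  interpret topological_group G TG by fact
  have "continuous_map TG (prod_topology (vietoris TG) TG) (\<lambda>g. ({\<one>\<^bsub>G\<^esub>, g}, g))"
    using continuous_map_vietoris_pair[of "\<one>\<^bsub>G\<^esub>" TG]
    by (intro continuous_map_pairedI) (simp_all add: topspace_eq)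
  then show ?thesis
    by (auto simp: birget_rhodes_topology_def continuous_map_in_subtopology birget_rhodes_def
        topspace_eq)
qed


section \<open>Continuity of the correspondence\<close>

theorem theorem4p13:
  fixes G :: "('g, 'm) monoid_scheme" and TG :: "'g topology"
    and S :: "('s, 'n) monoid_scheme" and TS :: "'s topology"
  assumes G: "topological_group G TG"
    and S: "topological_inverse_monoid S TS"
    and E: "has_small_semilattices (idempotent_order S) (subtopology TS (idempotents S))"
  shows "(\<forall>\<theta>. unital_premorphism G S \<theta> \<and> continuous_map TG TS \<theta> \<longrightarrow>
            continuous_map (birget_rhodes_topology G TG) TS (associated_hom G S \<theta>)) \<and>
         (\<forall>\<rho>. \<rho> \<in> hom (birget_rhodes G) S \<and> continuous_map (birget_rhodes_topology G TG) TS \<rho> \<longrightarrow>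
            continuous_map TG TS (associated_premorphism G \<rho>))"
proof (intro conjI allI impI)
  fix \<theta> assume \<theta>: "unital_premorphism G S \<theta> \<and> continuous_map TG TS \<theta>"
  interpret TG: topological_group G TG by (rule G)
  interpret TS: topological_inverse_monoid S TS by (rule S)
  interpret premorphism_of_group G S \<theta>
    using \<theta> by unfold_locales simp
  show "continuous_map (birget_rhodes_topology G TG) TS (associated_hom G S \<theta>)"
    using G S E \<theta> by (intro continuous_associated_hom) auto
next
  fix \<rho> assume "\<rho> \<in> hom (birget_rhodes G) S \<and> continuous_map (birget_rhodes_topology G TG) TS \<rho>"
  then have "continuous_map TG TS (\<rho> \<circ> (\<lambda>g. ({\<one>\<^bsub>G\<^esub>, g}, g)))"
    by (intro continuous_map_compose[OF continuous_birget_rhodes_section[OF G]]) simp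
  then show "continuous_map TG TS (associated_premorphism G \<rho>)"
    by (simp add: associated_premorphism_def o_def)
qed

end
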